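(* Let $n\ge 1$, $m\in[1;n]$, and let $\gamma=(\gamma_1,\dots,\gamma_m)$ be a tuple of nonnegative integers with $\gamma_1>0$, $\gamma_m>0$ and $\gamma_1+\dots+\gamma_m=n$. Assume that there is some $k\in[0;n-m]$ such that the configuration $(0^k,\gamma,0^{n-m-k})$ is weakly Łukasiewicz, and let $k$ be the maximal such value. Then, as formal power series in $t$, $$\sum_{i=0}^{n-m} t^i A_{(0^i,\gamma,0^{n-m-i})}(q) \equiv (t;q)_{n+1}\sum_{j\ge 0} t^j \prod_{a\in\mathrm{MSet}(\gamma)}[j+a] \pmod{t^{k+1}},$$ i.e. the coefficients of $t^i$ for $i\le k$ on both sides coincide. In particular, extracting the coefficient of $t^k$, $$A_{(0^k,\gamma,0^{n-m-k})}(q)=\sum_{j=0}^{k}(-1)^{j+k}q^{\binom{k-j}{2}}\genfrac{[}{]}{0pt}{}{n+1}{k-j}\prod_{a\in\mathrm{MSet}(\gamma)}[j+a].$$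
   Context: A configuration of size $n$ is a tuple $c=(c_1,\dots,c_n)$ of nonnegative integers with $\sum_i c_i=n$, viewed as $c_i$ balls at site $i\in\mathbb{Z}$. $\mathrm{MSet}(c)$ (and likewise $\mathrm{MSet}(\gamma)$ for a tuple $\gamma$) is the multiset containing each index $i$ with multiplicity $c_i$ (resp. $\gamma_i$). $0^k$ denotes $k$ consecutive zeros and juxtaposition denotes concatenation of tuples. Fix a real $q>0$. Random dynamic: the balls are dropped onto $\mathbb{Z}$ one at a time, each from its own site; a ball landing on a site occupied by an already settled ball moves one site left with probability $q/(1+q)$ and one site right with probability $1/(1+q)$, repeating until it reaches an unoccupied site, where it settles. The law of the final set of occupied sites does not depend on the dropping order. Let $\mathbb{P}_c(q)$ be the probability that the final set of occupied sites is $[1;n]$. Set $[i]=1+q+\dots+q^{i-1}$, $[n]!=[1]\cdots[n]$, $\genfrac{[}{]}{0pt}{}{n}{k}=\frac{[n]!}{[k]![n-k]!}$, and define the remixed Eulerian number $A_c(q)=[n]!\,\mathbb{P}_c(q)$ (a polynomial in $q$). The $q$-Pochhammer symbol is $(t;q)_N=\prod_{i=0}^{N-1}(1-tq^i)$. The left-to-right order of $c$ is the non-decreasing sequence $u_1\le\dots\le u_n$ listing $\mathrm{MSet}(c)$. A configuration $c$ is weakly Łukasiewicz if, when its balls are dropped in left-to-right order, in every run of the dynamic (with positive probability) in which all balls end in $[1;n]$, the set of occupied sites after each ball has settled is an interval. *)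

theory Defs
  imports
    "HOL-Probability.Probability"
    "HOL-Probability.SPMF"
    "HOL-Computational_Algebra.Formal_Power_Series"
begin

definition qint :: "'a::comm_ring_1 \<Rightarrow> nat \<Rightarrow> 'a" where
  "qint q i = (\<Sum>r<i. q ^ r)"

definition qfact :: "'a::comm_ring_1 \<Rightarrow> nat \<Rightarrow> 'a" where
  "qfact q n = (\<Prod>i=1..n. qint q i)"

definition qbinom :: "'a::field \<Rightarrow> nat \<Rightarrow> nat \<Rightarrow> 'a" where
  "qbinom q n k = qfact q n / (qfact q k * qfact q (n - k))"

definition qpoch :: "'a::comm_ring_1 \<Rightarrow> 'a \<Rightarrow> nat \<Rightarrow> 'a" where
  "qpoch t q N = (\<Prod>i<N. 1 - t * q ^ i)"

text \<open>
  A tuple $(c_1,\dots,c_n)$ is the list \<open>c\<close> with $c_i$ = \<open>c ! (i - 1)\<close>; a configuration of size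
  $n$ is a list with \<open>length c = n\<close> and \<open>sum_list c = n\<close>.
\<close>

definition MSet :: "nat list \<Rightarrow> nat multiset" where
  "MSet c = (\<Sum>i<length c. replicate_mset (c ! i) (Suc i))"

definition left_to_right :: "nat list \<Rightarrow> nat list" where
  "left_to_right c = sorted_list_of_multiset (MSet c)"

text \<open>
  Law of the site where a ball dropped at \<open>x\<close> settles when the sites in \<open>S\<close> are occupied. The least
  fixed point gives each site \<open>y\<close> the probability that the walk stops at \<open>y\<close> after finitely many
  steps.
\<close>

partial_function (spmf) settle :: "real \<Rightarrow> int set \<Rightarrow> int \<Rightarrow> int spmf" where
  "settle q S x =
    (if x \<notin> S then return_spmf x
     else bind_spmf (spmf_of_pmf (bernoulli_pmf (q / (1 + q))))
       (\<lambda>left. settle q S (if left then x - 1 else x + 1)))"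

text \<open>Law of the list of sites at which successively dropped balls settle.\<close>

fun drop_balls :: "real \<Rightarrow> int set \<Rightarrow> int list \<Rightarrow> int list spmf" where
  "drop_balls q S [] = return_spmf []"
| "drop_balls q S (x # xs) =
    bind_spmf (settle q S x) (\<lambda>y. map_spmf (Cons y) (drop_balls q (insert y S) xs))"

definition run_law :: "real \<Rightarrow> nat list \<Rightarrow> int list spmf" where
  "run_law q c = drop_balls q {} (map int (left_to_right c))"

text \<open>
  The law of the final set of occupied sites does not depend on the order in which the balls are
  dropped; the left-to-right order is used as the representative.
\<close>

definition fill_prob :: "real \<Rightarrow> nat list \<Rightarrow> real" where
  "fill_prob q c = spmf (map_spmf set (run_law q c)) {1..int (length c)}"

definition remixed_eulerian :: "real \<Rightarrow> nat list \<Rightarrow> real" where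
  "remixed_eulerian q c = qfact q (length c) * fill_prob q c"

definition weakly_Lukasiewicz :: "real \<Rightarrow> nat list \<Rightarrow> bool" where
  "weakly_Lukasiewicz q c \<longleftrightarrow>
    (\<forall>ys \<in> set_spmf (run_law q c). set ys \<subseteq> {1..int (length c)} \<longrightarrow>
      (\<forall>j \<in> {1..length ys}. \<exists>a b. set (take j ys) = {a..b}))"

definition padded :: "nat \<Rightarrow> nat list \<Rightarrow> nat \<Rightarrow> nat list" where
  "padded n g i = replicate i 0 @ g @ replicate (n - length g - i) 0"

end

theory Submission
  imports Defs
begin

text \<open>
  By gambler's ruin, a ball dropped at \<open>x + p\<close> onto the occupied interval \<open>[x+1; x+r]\<close> leaves it on the
  right with probability \<open>[p]/[r+1]\<close> and on the left with probability \<open>1 - [p]/[r+1]\<close>. Translate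
  everything so that the balls are dropped at the elements of \<open>MSet \<gamma>\<close> and the target is
  \<open>[1-i; n-i]\<close>. Any partial filling of a target can be completed with positive probability, so the
  weakly \<open>Lukasiewicz\<close> condition for \<open>k\<close> says that every reachable occupied set inside the target is an
  interval; since the balls lie in \<open>[1; m]\<close> and \<open>m \<le> n - k\<close>, this extends to every reachable occupied set
  inside \<open>[1-k; \<infinity>)\<close>, hence applies to all \<open>i \<le> k\<close>. If \<open>B r i\<close> is \<open>[r]!\<close> times the probability
  that the first \<open>r\<close> balls fill \<open>[1-i; r-i]\<close> and \<open>a\<close> is the next ball, then
  \<open>B (r+1) i = [a+i] B r i + ([r+1] - [a+i-1]) B r (i-1)\<close>. The coefficients of
  \<open>(t;q)\<^bsub>r+1\<^esub> \<Sum>\<^sub>j t\<^sup>j \<Prod>\<^sub>a [j+a]\<close> satisfy the same recursion, because the coefficients \<open>e s\<close> of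
  \<open>(t;q)\<^sub>N\<close> satisfy \<open>[s+1] e (s+1) = ([s] - [N]) e s\<close>.
\<close>

subsection \<open>Coefficients of the generating function\<close>

lemma qint_0 [simp]: "qint q 0 = 0"
  by (simp add: qint_def)

lemma qint_Suc: "qint q (Suc n) = qint q n + q ^ n"
  by (simp add: qint_def)

lemma qint_1 [simp]: "qint q (Suc 0) = 1"
  by (simp add: qint_def)

lemma qint_add: "qint q (m + n) = qint q m + q ^ m * qint q n"
  by (induction n) (simp_all add: qint_Suc algebra_simps power_add)

lemma qint_geometric: "(1 - q) * qint q n = 1 - q ^ n"
proof (induction n)
  case (Suc n)
  then show ?case by (simp add: qint_Suc distrib_left) (simp add: algebra_simps)
qed simp

lemma qint_pos: "q > 0 \<Longrightarrow> n > 0 \<Longrightarrow> qint (q :: real) n > 0"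
  unfolding qint_def by (rule sum_pos) auto

lemma qfact_Suc: "qfact q (Suc n) = qfact q n * qint q (Suc n)"
  by (simp add: qfact_def)

lemma qfact_pos: "q > 0 \<Longrightarrow> qfact (q :: real) n > 0"
  unfolding qfact_def by (rule prod_pos) (auto intro: qint_pos)

section \<open>Coefficients of the q-Pochhammer symbol\<close>

definition poch_coeff :: "'a::comm_ring_1 \<Rightarrow> nat \<Rightarrow> nat \<Rightarrow> 'a" where
  "poch_coeff q N s = fps_nth (qpoch fps_X (fps_const q) N) s"

lemma poch_coeff_0: "poch_coeff q 0 s = (if s = 0 then 1 else 0)"
  by (simp add: poch_coeff_def qpoch_def)

lemma qpoch_Suc: "qpoch t q (Suc N) = qpoch t q N * (1 - t * q ^ N)"
  by (simp add: qpoch_def)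

lemma poch_coeff_Suc:
  "poch_coeff q (Suc N) s = poch_coeff q N s - (if s = 0 then 0 else q ^ N * poch_coeff q N (s - 1))"
proof -
  have "qpoch fps_X (fps_const q) (Suc N) = qpoch fps_X (fps_const q) N
      - fps_const (q ^ N) * (fps_X * qpoch fps_X (fps_const q) N)"
    unfolding qpoch_Suc by (simp add: algebra_simps fps_const_power)
  then show ?thesis
    by (simp add: poch_coeff_def)
qed

lemma poch_coeff_at_0 [simp]: "poch_coeff q N 0 = 1"
  by (induction N) (simp_all add: poch_coeff_0 poch_coeff_Suc)

text \<open>Induction on \<open>N\<close> through the Pascal-type rule
  \<open>poch_coeff_Suc\<close>. For \<open>s <= N\<close> the difference on the right is
  \<open>- q^s [N-s]\<close>; the form without division makes sense in every commutative
  ring.\<close>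

lemma poch_coeff_ratio:
  "qint q (Suc s) * poch_coeff q N (Suc s) = (qint q s - qint q N) * poch_coeff q N s"
proof (induction N arbitrary: s)
  case 0
  then show ?case by (simp add: poch_coeff_0)
next
  case (Suc N)
  show ?case
  proof (cases s)
    case 0
    then show ?thesis using Suc[of 0] by (simp add: poch_coeff_Suc qint_Suc)
  next
    case (Suc s')
    define e0 e1 where "e0 = poch_coeff q N s'" and "e1 = poch_coeff q N s"
    have IH1: "qint q (Suc s) * poch_coeff q N (Suc s) = (qint q s - qint q N) * e1"
      using Suc.IH[of s] by (simp add: e1_def)
    have IH0: "qint q s * e1 = (qint q s' - qint q N) * e0"
      using Suc.IH[of s'] by (simp add: e0_def e1_def Suc)
    have s1: "qint q (Suc s) = 1 + q * qint q s" and s0: "qint q s = 1 + q * qint q s'"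
      and N1: "qint q (Suc N) = 1 + q * qint q N"
      using qint_add[of q 1 s] qint_add[of q 1 s'] qint_add[of q 1 N] by (simp_all add: Suc)
    \<comment> \<open>\<open>N1\<close> splits off the first power of \<open>q\<close> and
      \<open>N2\<close> the last one. Below, \<open>N2\<close> adjusts the factor of
      \<open>e1\<close> and \<open>N1\<close> that of \<open>e0\<close>.\<close>
    have N2: "qint q (Suc N) = qint q N + q ^ N"
      by (rule qint_Suc)
    have "qint q (Suc s) * poch_coeff q (Suc N) (Suc s)
        = (qint q s - qint q N) * e1 - q ^ N * (e1 + q * (qint q s * e1))"
      using IH1 by (simp add: poch_coeff_Suc e1_def[symmetric] s1 algebra_simps)
    also have "\<dots> = (qint q s - qint q (Suc N)) * e1 - q ^ N * ((q * qint q s' - q * qint q N) * e0)"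
      unfolding IH0 N2 by (simp add: algebra_simps)
    also have "\<dots> = (qint q s - qint q (Suc N)) * (e1 - q ^ N * e0)"
    proof -
      have "q * qint q s' - q * qint q N = qint q s - qint q (Suc N)"
        unfolding s0 N1 by simp
      then show ?thesis by (simp only:) (simp add: algebra_simps)
    qed
    also have "e1 - q ^ N * e0 = poch_coeff q (Suc N) s"
      by (simp add: poch_coeff_Suc e0_def e1_def Suc)
    finally show ?thesis .
  qed
qed

text \<open>The q-binomial theorem. For \<open>q > 0\<close> the factor \<open>[s+1]\<close> in
  \<open>poch_coeff_ratio\<close> is nonzero and cancels, so the formula follows by induction on
  \<open>s\<close>.\<close>

lemma poch_coeff_qbinom:
  fixes q :: real
  assumes "q > 0" "s \<le> N"
  shows "poch_coeff q N s = (-1) ^ s * q ^ (s choose 2) * qbinom q N s"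
  using assms(2)
proof (induction s)
  case 0
  then show ?case using qfact_pos[OF assms(1), of N] by (simp add: qbinom_def binomial_eq_0 qfact_def[of q 0])
next
  case (Suc s)
  have N: "N - s = Suc (N - Suc s)" using Suc.prems by simp
  have "qint q N = qint q s + q ^ s * qint q (N - s)"
    using qint_add[of q s "N - s"] Suc.prems by simp
  then have "qint q (Suc s) * poch_coeff q N (Suc s)
      = - (q ^ s * qint q (N - s)) * ((-1) ^ s * q ^ (s choose 2) * qbinom q N s)"
    using poch_coeff_ratio[of q s N] Suc by simp
  also have "qbinom q N s * qint q (N - s) = qint q (Suc s) * qbinom q N (Suc s)"
    using qint_pos[OF assms(1), of "Suc s"] qint_pos[OF assms(1), of "N - s"]
      qfact_pos[OF assms(1), of s] qfact_pos[OF assms(1), of "N - Suc s"]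
    unfolding qbinom_def N by (simp add: qfact_Suc field_simps)
  then have "- (q ^ s * qint q (N - s)) * ((-1) ^ s * q ^ (s choose 2) * qbinom q N s)
      = qint q (Suc s) * ((-1) ^ Suc s * q ^ (s + (s choose 2)) * qbinom q N (Suc s))"
    by (simp add: power_add mult.commute)
  finally have "poch_coeff q N (Suc s) = (-1) ^ Suc s * q ^ (s + (s choose 2)) * qbinom q N (Suc s)"
    using qint_pos[OF assms(1), of "Suc s"] by (subst (asm) mult_left_cancel) auto
  then show ?case by (simp add: numeral_2_eq_2)
qed

section \<open>The recursion in the number of balls\<close>

text \<open>The right-hand side of the theorem for an arbitrary list of balls, so that prefixes of
  the left-to-right order are covered. The Pochhammer length grows with the list.\<close>

definition eul_coeff :: "'a::comm_ring_1 \<Rightarrow> nat list \<Rightarrow> nat \<Rightarrow> 'a" where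
  "eul_coeff q as i = fps_nth (qpoch fps_X (fps_const q) (length as + 1)
     * Abs_fps (\<lambda>j. \<Prod>a\<leftarrow>as. qint q (j + a))) i"

lemma eul_coeff_sum:
  "eul_coeff q as i = (\<Sum>s=0..i. poch_coeff q (Suc (length as)) s * (\<Prod>a\<leftarrow>as. qint q (i - s + a)))"
  by (simp add: eul_coeff_def fps_mult_nth poch_coeff_def)

text \<open>A new ball \<open>a\<close> multiplies the factor at \<open>j\<close> by
  \<open>[j+a]\<close> and lengthens the Pochhammer symbol by one. Both effects are absorbed, term
  by term in the convolution, by \<open>key\<close>.\<close>

lemma eul_coeff_snoc:
  assumes "a > 0"
  shows "eul_coeff q (as @ [a]) i = qint q (a + i) * eul_coeff q as i
    + (if i = 0 then 0 else (qint q (Suc (length as)) - qint q (a + i - 1)) * eul_coeff q as (i - 1))"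
proof -
  define N where "N = Suc (length as)"
  define E where "E = poch_coeff q N"
  define f where "f j = (\<Prod>a\<leftarrow>as. qint q (j + a))" for j
  \<comment> \<open>The multipliers of \<open>E s\<close> and \<open>E (s - 1)\<close> on the right
    do not depend on \<open>s\<close>; summing over \<open>s\<close> therefore yields two complete
    convolutions.\<close>
  have key: "poch_coeff q (Suc N) s * qint q (i - s + a) = qint q (a + i) * E s
      + (if s = 0 then 0 else (qint q N - qint q (a + i - 1)) * E (s - 1))" if "s \<le> i" for s
  proof (cases s)
    case 0
    then show ?thesis by (simp add: E_def add.commute)
  next
    case (Suc s')
    define p where "p = i - s + a"
    have ai: "a + i = p + s" and ai1: "a + i - 1 = p + s'"
      using that assms Suc by (auto simp: p_def)
    \<comment> \<open>Both sides equal \<open>(1 - q) [N] [p]\<close>.\<close>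
    have "(1 - q ^ N) * qint q p = (1 - q ^ p) * qint q N"
      using qint_geometric[of q N] qint_geometric[of q p] by (metis mult.assoc mult.commute)
    then have c: "(qint q N - qint q p - q ^ p * qint q N) * E s' = - (q ^ N * qint q p) * E s'"
      by (simp add: algebra_simps)
    have "q ^ p * (qint q s * E s) = q ^ p * ((qint q s' - qint q N) * E s')"
      using poch_coeff_ratio[of q s' N] by (simp add: E_def Suc)
    then have "qint q (a + i) * E s + (qint q N - qint q (a + i - 1)) * E s'
        = qint q p * E s + (qint q N - qint q p - q ^ p * qint q N) * E s'"
      unfolding ai1 unfolding ai qint_add by (simp add: algebra_simps)
    also have "\<dots> = poch_coeff q (Suc N) s * qint q p"
      unfolding c by (simp add: poch_coeff_Suc Suc E_def algebra_simps)
    finally show ?thesis by (simp add: Suc p_def)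
  qed
  have "eul_coeff q (as @ [a]) i
      = (\<Sum>s=0..i. poch_coeff q (Suc N) s * qint q (i - s + a) * f (i - s))"
    by (simp add: eul_coeff_sum N_def f_def algebra_simps)
  also have "\<dots> = (\<Sum>s=0..i. qint q (a + i) * (E s * f (i - s))
      + (if s = 0 then 0 else (qint q N - qint q (a + i - 1)) * (E (s - 1) * f (i - s))))"
  proof (rule sum.cong[OF refl])
    fix s assume "s \<in> {0..i}"
    then have "s \<le> i" by simp
    show "poch_coeff q (Suc N) s * qint q (i - s + a) * f (i - s) = qint q (a + i) * (E s * f (i - s))
      + (if s = 0 then 0 else (qint q N - qint q (a + i - 1)) * (E (s - 1) * f (i - s)))"
      unfolding key[OF \<open>s \<le> i\<close>] by (simp add: algebra_simps)
  qed
  also have "\<dots> = qint q (a + i) * eul_coeff q as i + (\<Sum>s=0..i.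
      (if s = 0 then 0 else (qint q N - qint q (a + i - 1)) * (E (s - 1) * f (i - s))))"
    by (simp add: sum.distrib eul_coeff_sum N_def E_def f_def sum_distrib_left)
  also have "(\<Sum>s=0..i.
      (if s = 0 then 0 else (qint q N - qint q (a + i - 1)) * (E (s - 1) * f (i - s))))
      = (if i = 0 then 0 else (qint q N - qint q (a + i - 1)) * eul_coeff q as (i - 1))"
  proof (cases i)
    case (Suc i')
    have "(\<Sum>s=0..i.
      (if s = 0 then 0 else (qint q N - qint q (a + i - 1)) * (E (s - 1) * f (i - s))))
      = (\<Sum>s=0..i'. (qint q N - qint q (a + i - 1)) * (E s * f (i' - s)))"
      unfolding Suc sum.atLeast0_atMost_Suc_shift by simp
    then show ?thesis
      by (simp add: Suc eul_coeff_sum sum_distrib_left E_def f_def N_def)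
  qed simp
  finally show ?thesis by (simp add: N_def)
qed

text \<open>Without balls the series is \<open>(1 - t)\<close> times the geometric series.\<close>

lemma eul_coeff_Nil: "eul_coeff q [] i = (if i = 0 then 1 else 0)"
proof (cases i)
  case (Suc i')
  have "(\<Sum>s=0..i. poch_coeff q (Suc 0) s) = (\<Sum>s=0..i'. if s = 0 then (0::'a) else 0)"
    unfolding Suc sum.atLeast0_atMost_Suc_shift
    by (simp add: poch_coeff_Suc poch_coeff_0 if_distrib cong: if_cong)
  then show ?thesis by (simp add: eul_coeff_sum Suc)
qed (simp add: eul_coeff_sum)

lemma eul_coeff_singleton_1: "eul_coeff q [1] i = (if i = 0 then 1 else 0)"
  using eul_coeff_snoc[of 1 q "[]" i] by (cases i) (auto simp: eul_coeff_Nil)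

subsection \<open>Settling and dropping balls\<close>

lemma spmf_bind_bernoulli:
  assumes "0 \<le> p" "p \<le> 1"
  shows "spmf (bind_pmf (bernoulli_pmf p) h) y
    = p * spmf (h True) y + (1 - p) * spmf (h False) y"
  using assms by (simp add: pmf_bind)

lemma settle_free: "x \<notin> S \<Longrightarrow> settle q S x = return_spmf x"
  by (subst settle.simps) simp

lemma spmf_settle_occupied:
  assumes "q > 0" "x \<in> S"
  shows "spmf (settle q S x) y
    = (q * spmf (settle q S (x - 1)) y + spmf (settle q S (x + 1)) y) / (1 + q)"
proof -
  have "1 - q / (1 + q) = 1 / (1 + q)" using assms(1) by (simp add: field_simps)
  with assms show ?thesis
    by (subst settle.simps) (simp add: spmf_bind_bernoulli add_divide_distrib)
qed

lemma set_spmf_settle_occupied: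
  assumes "q > 0" "x \<in> S"
  shows "set_spmf (settle q S x) = set_spmf (settle q S (x - 1)) \<union> set_spmf (settle q S (x + 1))"
proof -
  have "set_pmf (bernoulli_pmf (q / (1 + q))) = UNIV"
    using assms(1) by (intro set_pmf_bernoulli) (auto simp: field_simps)
  with assms(2) show ?thesis
    by (subst settle.simps) (auto simp: set_spmf_bind_pmf bind_UNION split: if_splits)
qed

section \<open>Gambler's ruin on an occupied interval\<close>

text \<open>The mean value equation says that each increment of \<open>f\<close> is \<open>q\<close>
  times the preceding one, so the increments sum to a multiple of a q-integer.\<close>

lemma qint_harmonic:
  fixes f :: "nat \<Rightarrow> real"
  assumes "q > 0"
    and "\<And>j. 1 \<le> j \<Longrightarrow> j \<le> r \<Longrightarrow> f j = (q * f (j - 1) + f (j + 1)) / (1 + q)"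
    and "j \<le> Suc r"
  shows "f j = f 0 + qint q j * (f 1 - f 0)"
proof -
  have inc: "j \<le> r \<Longrightarrow> f (Suc j) - f j = q ^ j * (f 1 - f 0)" for j
  proof (induction j)
    case (Suc j)
    have "f (Suc j) * (1 + q) = q * f j + f (Suc (Suc j))"
      using assms(2)[of "Suc j"] Suc.prems assms(1) by (simp add: field_simps)
    then have "f (Suc (Suc j)) - f (Suc j) = q * (f (Suc j) - f j)"
      by (simp add: algebra_simps)
    with Suc show ?case by simp
  qed simp
  show ?thesis
    using assms(3)
  proof (induction j)
    case (Suc j)
    then show ?case using inc[of j] by (simp add: qint_Suc algebra_simps)
  qed simp
qed

text \<open>As a function of the starting site, the probability of settling at \<open>y\<close> is
  harmonic on the interval, and its values at the two free neighbours \<open>x\<close> and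
  \<open>x + r + 1\<close> are known.\<close>

lemma spmf_settle_interval:
  assumes "q > 0" "p \<le> Suc r"
  shows "spmf (settle q {x + 1..x + int r} (x + int p)) y =
    (if y = x + int r + 1 then qint q p / qint q (Suc r)
     else if y = x then 1 - qint q p / qint q (Suc r) else 0)"
proof -
  define f where "f j = spmf (settle q {x + 1..x + int r} (x + int j)) y" for j
  have f0: "f 0 = (if y = x then 1 else 0)"
    by (simp add: f_def settle_free)
  have fr: "f (Suc r) = (if y = x + int r + 1 then 1 else 0)"
    by (simp add: f_def settle_free algebra_simps)
  have "f j = f 0 + qint q j * (f 1 - f 0)" if "j \<le> Suc r" for j
  proof (rule qint_harmonic[OF assms(1) _ that])
    fix j assume j: "1 \<le> j" "j \<le> r"
    show "f j = (q * f (j - 1) + f (j + 1)) / (1 + q)"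
      unfolding f_def using j assms(1)
      by (subst spmf_settle_occupied) (auto simp: of_nat_diff algebra_simps)
  qed
  \<comment> \<open>Evaluation at \<open>Suc r\<close> determines the unknown increment
    \<open>f 1 - f 0\<close>.\<close>
  from this[of p] this[of "Suc r"] assms(2)
  have "f p = f 0 + qint q p * ((f (Suc r) - f 0) / qint q (Suc r))"
    using qint_pos[OF assms(1), of "Suc r"] by simp
  then show ?thesis
    unfolding f0 fr f_def[symmetric] by (auto simp: f_def)
qed

text \<open>The walk is translation invariant; as \<open>settle\<close> is a least fixed point, this
  is shown by fixed point induction.\<close>

lemma settle_translate:
  "settle q ((+) d ` S) (d + x) = map_spmf ((+) d) (settle q S x)"
proof (induction arbitrary: S x rule: settle.fixp_induct)
  case 1
  show ?case by simp
next
  case 2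
  show ?case by simp
next
  case (3 g)
  have "g q ((+) d ` S) (if b then d + x - 1 else d + x + 1)
    = map_spmf ((+) d) (g q S (if b then x - 1 else x + 1))" for b
    using 3[of S "if b then x - 1 else x + 1"] by (cases b) (simp_all add: add_diff_eq add.assoc)
  then show ?case
    by (auto simp: map_bind_pmf image_iff)
qed

lemma drop_balls_translate:
  "drop_balls q ((+) d ` S) (map ((+) d) xs) = map_spmf (map ((+) d)) (drop_balls q S xs)"
proof (induction xs arbitrary: S)
  case (Cons x xs)
  show ?case
    by (simp add: settle_translate bind_map_spmf map_spmf_bind_spmf spmf.map_comp o_def
        image_insert[symmetric] Cons.IH del: image_insert)
qed simp

lemma drop_balls_append:
  "drop_balls q S (xs @ zs) =
    bind_spmf (drop_balls q S xs) (\<lambda>ys. map_spmf ((@) ys) (drop_balls q (S \<union> set ys) zs))"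
proof (induction xs arbitrary: S)
  case (Cons x xs)
  have "(\<lambda>zs. y # ys @ zs) = (@) (y # ys)" for y :: int and ys
    by auto
  then show ?case
    by (simp add: Cons.IH bind_map_spmf map_spmf_bind_spmf spmf.map_comp o_def)
next
  case Nil
  have "(@) [] = (id :: int list \<Rightarrow> _)" by auto
  then show ?case by (simp add: spmf.map_id)
qed

lemma length_drop_balls: "ys \<in> set_spmf (drop_balls q S xs) \<Longrightarrow> length ys = length xs"
  by (induction xs arbitrary: S ys) (auto simp: set_bind_spmf bind_UNION)

section \<open>Completing a partial filling\<close>

text \<open>Stepping right at every collision has positive probability and meets a free site no
  later than \<open>h\<close>.\<close>

lemma settle_right_of:
  assumes "q > 0" "x \<le> h" "h \<notin> S"
  shows "\<exists>y \<in> set_spmf (settle q S x). x \<le> y \<and> y \<le> h \<and> y \<notin> S"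
  using assms(2)
proof (induction "nat (h - x)" arbitrary: x rule: less_induct)
  case less
  show ?case
  proof (cases "x \<in> S")
    case True
    then have "x < h" using less.prems assms(3) by (cases "x = h") auto
    then obtain y where "y \<in> set_spmf (settle q S (x + 1))" "x + 1 \<le> y" "y \<le> h" "y \<notin> S"
      using less.hyps[of "x + 1"] by auto
    then show ?thesis
      using set_spmf_settle_occupied[OF assms(1) True] by (intro bexI[of _ y]) auto
  qed (use less.prems in \<open>simp add: settle_free\<close>)
qed

lemma settle_left_of:
  assumes "q > 0" "h \<le> x" "h \<notin> S"
  shows "\<exists>y \<in> set_spmf (settle q S x). h \<le> y \<and> y \<le> x \<and> y \<notin> S"
  using assms(2)
proof (induction "nat (x - h)" arbitrary: x rule: less_induct)
  case less
  show ?case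
  proof (cases "x \<in> S")
    case True
    then have "h < x" using less.prems assms(3) by (cases "x = h") auto
    then obtain y where "y \<in> set_spmf (settle q S (x - 1))" "h \<le> y" "y \<le> x - 1" "y \<notin> S"
      using less.hyps[of "x - 1"] by auto
    then show ?thesis
      using set_spmf_settle_occupied[OF assms(1) True] by (intro bexI[of _ y]) auto
  qed (use less.prems in \<open>simp add: settle_free\<close>)
qed

text \<open>By counting, a free site \<open>h\<close> remains as long as balls are left. The next
  ball can walk straight towards \<open>h\<close> and settles between its start and
  \<open>h\<close>, hence inside the target.\<close>

lemma drop_balls_completable:
  assumes "q > 0" "S \<subseteq> {A..B}" "set xs \<subseteq> {A..B}" "card S + length xs \<le> card {A..B}"
  shows "\<exists>ys \<in> set_spmf (drop_balls q S xs). set ys \<subseteq> {A..B}"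
  using assms(2-)
proof (induction xs arbitrary: S)
  case (Cons x xs)
  have "S \<noteq> {A..B}" using Cons.prems by auto
  then obtain h where h: "h \<in> {A..B}" "h \<notin> S" using Cons.prems by blast
  have x: "x \<in> {A..B}" using Cons.prems by simp
  obtain y where y: "y \<in> set_spmf (settle q S x)" "y \<in> {A..B}" "y \<notin> S"
  proof (cases "x \<le> h")
    case True
    with settle_right_of[OF assms(1) True h(2)] h(1) x that show ?thesis by fastforce
  next
    case False
    with settle_left_of[OF assms(1) _ h(2), of x] h(1) x that show ?thesis by fastforce
  qed
  have "finite S" using Cons.prems finite_subset by blast
  then have "\<exists>ys \<in> set_spmf (drop_balls q (insert y S) xs). set ys \<subseteq> {A..B}"
    using Cons.prems y by (intro Cons.IH) auto
  then show ?case using y by (fastforce simp: set_bind_spmf bind_UNION)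
qed simp

subsection \<open>Padded configurations\<close>

text \<open>Trailing zeros contribute nothing, and each leading zero shifts all indices by
  one.\<close>

lemma MSet_padded:
  "MSet (padded n g i) = image_mset ((+) i) (MSet g)"
proof -
  have f: "image_mset h (\<Sum>j<l. M j) = (\<Sum>j<l. image_mset h (M j))"
    for h :: "nat \<Rightarrow> nat" and M and l :: nat
    by (induction l) auto
  have a: "MSet (xs @ replicate l 0) = MSet xs" for xs l
    by (induction l) (simp_all add: MSet_def nth_append replicate_append_same[symmetric]
        append_assoc[symmetric] del: append_assoc)
  have b: "MSet (0 # xs) = image_mset Suc (MSet xs)" for xs
    by (simp only: MSet_def list.size sum.lessThan_Suc_shift f add_0_right add_Suc_right
        image_replicate_mset nth_Cons_0 nth_Cons_Suc replicate_mset_0 add_0_left)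
  have "MSet (replicate i 0 @ xs) = image_mset ((+) i) (MSet xs)" for xs
    by (induction i) (simp_all add: b image_mset.compositionality o_def)
  then show ?thesis
    by (simp add: padded_def a flip: append_assoc)
qed

lemma left_to_right_padded:
  "left_to_right (padded n g i) = map ((+) i) (left_to_right g)"
proof -
  have "sorted (map ((+) i) (left_to_right g))"
    by (simp add: left_to_right_def sorted_map sorted_wrt_mono_rel)
  then have "sorted_list_of_multiset (mset (map ((+) i) (left_to_right g))) = map ((+) i) (left_to_right g)"
    by (simp add: sorted_sort_id del: mset_map)
  then show ?thesis
    by (simp add: left_to_right_def MSet_padded)
qed

lemma mset_left_to_right: "mset (left_to_right g) = MSet g"
  by (simp add: left_to_right_def)

lemma size_MSet: "size (MSet g) = sum_list g"
proof -
  have "size (\<Sum>j<l. M j) = (\<Sum>j<l. size (M j))" for M :: "nat \<Rightarrow> nat multiset" and l :: nat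
    by (induction l) auto
  then show ?thesis
    by (simp add: MSet_def sum_list_sum_nth atLeast0LessThan)
qed

lemma set_mset_MSet: "set_mset (MSet g) = {Suc j |j. j < length g \<and> g ! j > 0}"
proof -
  have "set_mset (\<Sum>j<l. M j) = (\<Union>j<l. set_mset (M j))" for M :: "nat \<Rightarrow> nat multiset" and l :: nat
    by (induction l) (auto simp: less_Suc_eq)
  then show ?thesis
    by (auto simp: MSet_def split: if_splits)
qed

lemma run_law_padded:
  "run_law q (padded n g i)
    = map_spmf (map ((+) (int i))) (drop_balls q {} (map int (left_to_right g)))"
  using drop_balls_translate[of q "int i" "{}" "map int (left_to_right g)"]
  by (simp add: run_law_def left_to_right_padded o_def)

definition occupied_law :: "real \<Rightarrow> nat list \<Rightarrow> int set spmf" where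
  "occupied_law q as = map_spmf set (drop_balls q {} (map int as))"

lemma occupied_law_snoc:
  "occupied_law q (as @ [a]) = bind_spmf (occupied_law q as) (\<lambda>S. map_spmf (\<lambda>y. insert y S) (settle q S (int a)))"
  by (simp add: occupied_law_def drop_balls_append map_spmf_bind_spmf bind_map_spmf spmf.map_comp o_def
      map_spmf_conv_bind_spmf[symmetric])

text \<open>Translation moves the target instead of the balls, so all paddings are read off one and
  the same law.\<close>

lemma fill_prob_padded:
  assumes "length (padded n g i) = n"
  shows "fill_prob q (padded n g i) = spmf (occupied_law q (left_to_right g)) {1 - int i..int n - int i}"
proof -
  have "inj ((`) ((+) (int i)))"
    by (intro injI) (simp add: inj_image_eq_iff)
  moreover have "{1..int n} = (+) (int i) ` {1 - int i..int n - int i}"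
    by simp
  moreover have "map_spmf set (run_law q (padded n g i))
      = map_spmf ((`) ((+) (int i))) (occupied_law q (left_to_right g))"
    by (simp add: run_law_padded occupied_law_def spmf.map_comp o_def)
  ultimately show ?thesis
    unfolding fill_prob_def assms by (simp only: spmf_map_inj')
qed

subsection \<open>Occupied sets under the weak Lukasiewicz condition\<close>

lemma insert_atLeastAtMost_right_iff:
  fixes a b :: int
  assumes "a \<le> b + 1"
  shows "insert y {a..b} = {a..b + 1} \<longleftrightarrow> y = b + 1"
proof
  assume "insert y {a..b} = {a..b + 1}"
  moreover have "b + 1 \<in> {a..b + 1}" using assms by simp
  ultimately have "b + 1 \<in> insert y {a..b}" by simp
  then show "y = b + 1" by simp
qed (use assms in auto)

lemma insert_atLeastAtMost_left_iff:
  fixes a b :: int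
  assumes "a \<le> b + 1"
  shows "insert y {a..b} = {a - 1..b} \<longleftrightarrow> y = a - 1"
proof
  assume "insert y {a..b} = {a - 1..b}"
  moreover have "a - 1 \<in> {a - 1..b}" using assms by simp
  ultimately have "a - 1 \<in> insert y {a..b}" by simp
  then show "y = a - 1" by simp
qed (use assms in auto)

text \<open>In the application \<open>as\<close> is the left-to-right order of the unpadded tuple,
  and \<open>intervals\<close> is the weakly Lukasiewicz condition for \<open>k\<close> translated
  by \<open>-k\<close>.\<close>

context
  fixes q :: real and as :: "nat list" and n m k :: nat
  assumes q: "q > 0"
    and len: "length as = n"
    and first: "as ! 0 = 1"
    and bound: "set as \<subseteq> {1..m}"
    and n: "n \<ge> 1"
    and k: "m + k \<le> n"
    and intervals: "\<And>ys j. ys \<in> set_spmf (drop_balls q {} (map int as)) \<Longrightarrow>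
      set ys \<subseteq> {1 - int k..int n - int k} \<Longrightarrow> 1 \<le> j \<Longrightarrow> j \<le> length ys \<Longrightarrow>
      \<exists>a b. set (take j ys) = {a..b}"
begin

text \<open>
  Otherwise the next ball would settle away from the interval, and completing that run inside the
  target would contradict \<open>intervals\<close>.
\<close>

lemma next_ball_le:
  assumes S: "{x + 1..x + int r} \<in> set_spmf (occupied_law q (take r as))"
    and r: "1 \<le> r" "r < n" and x: "- int k \<le> x"
  shows "int (as ! r) \<le> x + int r + 1"
proof (rule ccontr)
  assume far: "\<not> int (as ! r) \<le> x + int r + 1"
  define u where "u = int (as ! r)"
  let ?W = "{1 - int k..int n - int k}"
  \<comment> \<open>\<open>1 - k <= 1 <= a <= m <= n - k\<close>.\<close>
  have as_W: "int a \<in> ?W" if "a \<in> set as" for a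
    using bound k that by fastforce
  have uW: "u \<in> ?W"
    unfolding u_def using r len by (intro as_W) auto
  from S obtain ys where ys: "ys \<in> set_spmf (drop_balls q {} (map int (take r as)))"
    and set_ys: "set ys = {x + 1..x + int r}"
    by (auto simp: occupied_law_def)
  have len_ys: "length ys = r"
    using length_drop_balls[OF ys] r len by simp
  \<comment> \<open>The upper bound holds because \<open>u\<close> lies in \<open>?W\<close> and to
    the right of the interval.\<close>
  have ysW: "set ys \<subseteq> ?W"
    using set_ys far uW x by (auto simp: u_def)
  have u_free: "u \<notin> set ys"
    using far by (auto simp: set_ys u_def)
  have "\<exists>zs \<in> set_spmf (drop_balls q (insert u (set ys)) (map int (drop (Suc r) as))). set zs \<subseteq> ?W"
  proof (rule drop_balls_completable[OF q])
    show "insert u (set ys) \<subseteq> ?W" using ysW uW by simp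
    show "set (map int (drop (Suc r) as)) \<subseteq> ?W" using as_W by (auto dest: in_set_dropD)
    show "card (insert u (set ys)) + length (map int (drop (Suc r) as)) \<le> card ?W"
      using u_free set_ys r len by simp
  qed
  then obtain zs where zs: "zs \<in> set_spmf (drop_balls q (insert u (set ys)) (map int (drop (Suc r) as)))"
    and zsW: "set zs \<subseteq> ?W" by blast
  have "as = take r as @ as ! r # drop (Suc r) as"
    using r len by (simp add: id_take_nth_drop)
  then have "map int as = map int (take r as) @ u # map int (drop (Suc r) as)"
    by (metis list.simps(9) map_append u_def)
  then have "ys @ u # zs \<in> set_spmf (drop_balls q {} (map int as))"
    using ys zs u_free
    by (auto simp: drop_balls_append set_bind_spmf bind_UNION settle_free intro!: bexI[of _ ys])
  then obtain a b where "set (take (Suc r) (ys @ u # zs)) = {a..b}"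
    using intervals[of "ys @ u # zs" "Suc r"] ysW uW zsW len_ys by auto
  then have ab: "insert u {x + 1..x + int r} = {a..b}"
    using len_ys set_ys by simp
  \<comment> \<open>An interval containing \<open>x + 1\<close> and \<open>u\<close> also contains
    the site \<open>x + r + 1\<close> between them, which is unoccupied.\<close>
  then have "x + 1 \<in> {a..b}" "u \<in> {a..b}"
    using r by auto
  then have "x + int r + 1 \<in> insert u {x + 1..x + int r}"
    using far unfolding ab by (auto simp: u_def)
  then show False using far by (auto simp: u_def)
qed

lemma set_settle_interval:
  assumes "x + 1 \<le> int a" "int a \<le> x + int r + 1"
  shows "set_spmf (settle q {x + 1..x + int r} (int a)) \<subseteq> {x, x + int r + 1}"
proof
  fix y assume "y \<in> set_spmf (settle q {x + 1..x + int r} (int a))"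
  then have "spmf (settle q {x + 1..x + int r} (x + int (nat (int a - x)))) y \<noteq> 0"
    using assms by (simp add: in_set_spmf_iff_spmf)
  then show "y \<in> {x, x + int r + 1}"
    using assms by (subst (asm) spmf_settle_interval[OF q]) (auto split: if_splits)
qed

lemma occupied_law_1: "occupied_law q (take 1 as) = return_spmf {1}"
  using n len first by (cases as) (simp_all add: occupied_law_def settle_free)

lemma take_Suc_as: "r < n \<Longrightarrow> take (Suc r) as = take r as @ [as ! r]"
  by (simp add: take_Suc_conv_app_nth len)

lemma as_nth: "r < n \<Longrightarrow> 1 \<le> as ! r \<and> as ! r \<le> m"
  using bound len nth_mem[of r as] by (metis atLeastAtMost_iff subsetD)

text \<open>Only a left bound on \<open>S\<close> is imposed, so targets for all
  \<open>i <= k\<close> are covered. As \<open>x <= 0\<close>, the next ball does not start left of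
  the interval; carrying its upper bound through the induction makes it settle at one of the two
  ends.\<close>

lemma occupied_law_interval:
  assumes "1 \<le> r" "r \<le> n" "S \<in> set_spmf (occupied_law q (take r as))" "S \<subseteq> {1 - int k..}"
  shows "\<exists>x \<le> 0. S = {x + 1..x + int r} \<and> (r < n \<longrightarrow> int (as ! r) \<le> x + int r + 1)"
  using assms
proof (induction r arbitrary: S rule: nat_induct_at_least)
  case base
  then have S: "S = {0 + 1..0 + int 1}" using occupied_law_1 by simp
  moreover have "int (as ! 1) \<le> 0 + int 1 + 1" if "1 < n"
    using base S that by (intro next_ball_le) auto
  ultimately show ?case by (intro exI[of _ 0]) auto
next
  case (Suc r)
  from Suc.prems obtain y S' where S: "S = insert y S'" and S': "S' \<in> set_spmf (occupied_law q (take r as))"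
    and y: "y \<in> set_spmf (settle q S' (int (as ! r)))"
    by (auto simp: take_Suc_as occupied_law_snoc set_bind_spmf bind_UNION)
  obtain x where x: "x \<le> 0" "S' = {x + 1..x + int r}" "int (as ! r) \<le> x + int r + 1"
    using Suc.IH[OF _ S'] Suc.prems S by auto
  have "y \<in> {x, x + int r + 1}"
    using y set_settle_interval[of x "as ! r" r] as_nth[of r] x Suc.prems by auto
  then obtain x' where x': "x' \<le> 0" "S = {x' + 1..x' + int (Suc r)}"
  proof
    assume "y = x"
    then have "S = {(x - 1) + 1..(x - 1) + int (Suc r)}"
      unfolding S x(2) by auto
    with x(1) that[of "x - 1"] show ?thesis by simp
  next
    assume "y \<in> {x + int r + 1}"
    then have "S = {x + 1..x + int (Suc r)}"
      unfolding S x(2) by auto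
    with x(1) that[of x] show ?thesis by simp
  qed
  have "int (as ! Suc r) \<le> x' + int (Suc r) + 1" if "Suc r < n"
  proof (rule next_ball_le[OF _ _ that])
    show "- int k \<le> x'"
      using Suc.prems(3) unfolding x'(2) by auto
  qed (use Suc.prems x' in auto)
  with x' show ?case by blast
qed

text \<open>A filled target arises from the interval lacking its right end or from the one lacking
  its left end. The factor \<open>[r]!\<close> clears the denominators of the ruin probabilities and
  leaves the recursion \<open>eul_coeff_snoc\<close>.\<close>

lemma occupied_law_eul_coeff:
  assumes "1 \<le> r" "r \<le> n" "i \<le> k"
  shows "qfact q r * spmf (occupied_law q (take r as)) {1 - int i..int r - int i} = eul_coeff q (take r as) i"
  using assms
proof (induction r arbitrary: i rule: nat_induct_at_least)
  case base
  have "take 1 as = [1]" using n len first by (cases as) auto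
  moreover have "{1} = {1 - int i..1 - int i} \<longleftrightarrow> i = 0" by auto
  ultimately show ?case
    unfolding occupied_law_1 by (auto simp: eul_coeff_singleton_1[simplified] qfact_def indicator_def)
next
  case (Suc r)
  define a where "a = as ! r"
  \<comment> \<open>\<open>S1\<close> and \<open>S2\<close> are \<open>T\<close> without its right
    and left end; \<open>c1\<close> and \<open>c2\<close> are the probabilities that ball
    \<open>a\<close> fills the missing end.\<close>
  define S1 S2 T where "S1 = {1 - int i..int r - int i}" and "S2 = {2 - int i..int r + 1 - int i}"
    and "T = {1 - int i..int (Suc r) - int i}"
  define c1 c2 where "c1 = qint q (a + i) / qint q (Suc r)"
    and "c2 = 1 - qint q (a + i - 1) / qint q (Suc r)"
  have a: "1 \<le> a" using as_nth[of r] Suc.prems by (simp add: a_def)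
  have r: "1 \<le> r" "r < n" using Suc by auto
  have step: "spmf (map_spmf (\<lambda>y. insert y S) (settle q S (int a))) T
      = c1 * indicator {S1} S + c2 * indicator {S2} S"
    if S: "S \<in> set_spmf (occupied_law q (take r as))" for S
  proof (cases "S \<subseteq> {1 - int k..}")
    case False
    have "T \<subseteq> {1 - int k..}" "S1 \<subseteq> {1 - int k..}" "S2 \<subseteq> {1 - int k..}"
      using Suc.prems by (auto simp: T_def S1_def S2_def)
    with False have "S \<noteq> S1" "S \<noteq> S2" "(\<lambda>y. insert y S) -` {T} = {}"
      by auto
    then show ?thesis by (simp add: spmf_map)
  next
    case True
    then obtain x where x: "x \<le> 0" "S = {x + 1..x + int r}" "int a \<le> x + int r + 1"
      using occupied_law_interval[OF _ _ S] r by (auto simp: a_def)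
    define p where "p = nat (int a - x)"
    have p: "p \<le> Suc r" "int a = x + int p" using x a by (auto simp: p_def)
    \<comment> \<open>The cases are \<open>S = S1\<close>, \<open>S = S2\<close>, and
      \<open>S\<close> not contained in \<open>T\<close>.\<close>
    consider "x = - int i" | "x = 1 - int i" | "x < - int i \<or> x > 1 - int i" by linarith
    then show ?thesis
    proof cases
      case 1
      have "(\<lambda>y. insert y S) -` {T} = {x + int r + 1}"
        using insert_atLeastAtMost_right_iff[of "1 - int i" "int r - int i"]
        unfolding x(2) T_def 1 by (auto simp: algebra_simps)
      moreover have "S = S1" "S \<noteq> S2" "p = a + i"
        using r x p 1 by (auto simp: S1_def S2_def Icc_eq_Icc)
      ultimately show ?thesis
        unfolding p(2) x(2) using spmf_settle_interval[OF q p(1), of x "x + int r + 1"]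
        by (simp add: spmf_map spmf_conv_measure_spmf[symmetric] c1_def)
    next
      case 2
      have "(\<lambda>y. insert y S) -` {T} = {x}"
        using insert_atLeastAtMost_left_iff[of "2 - int i" "int r + 1 - int i"]
        unfolding x(2) T_def 2 by (auto simp: algebra_simps)
      moreover have "S \<noteq> S1" "S = S2" "p = a + i - 1"
        using r x p 2 a by (auto simp: S1_def S2_def Icc_eq_Icc)
      ultimately show ?thesis
        unfolding p(2) x(2) using spmf_settle_interval[OF q p(1), of x x]
        by (simp add: spmf_map spmf_conv_measure_spmf[symmetric] c2_def)
    next
      case 3
      have "S \<noteq> S1" "S \<noteq> S2"
        using r x 3 by (auto simp: S1_def S2_def Icc_eq_Icc)
      moreover have "\<not> S \<subseteq> T"
        using r x 3 by (auto simp: T_def)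
      then have "(\<lambda>y. insert y S) -` {T} = {}"
        by auto
      ultimately show ?thesis by (simp add: spmf_map)
    qed
  qed
  have "spmf (occupied_law q (take (Suc r) as)) T
      = (\<integral>S. c1 * indicator {S1} S + c2 * indicator {S2} S \<partial>measure_spmf (occupied_law q (take r as)))"
    unfolding take_Suc_as[OF r(2)] occupied_law_snoc spmf_bind a_def[symmetric]
    by (rule integral_cong_AE) (simp_all add: AE_measure_spmf_iff step)
  also have "\<dots> = c1 * spmf (occupied_law q (take r as)) S1 + c2 * spmf (occupied_law q (take r as)) S2"
  proof -
    have "integrable (measure_spmf M) (\<lambda>S. c * indicator {S'} S :: real)" for M c and S' :: "int set"
      by (rule measure_spmf.integrable_const_bound[of _ "\<bar>c\<bar>"]) (auto simp: indicator_def)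
    then show ?thesis
      by (simp add: spmf_conv_measure_spmf)
  qed
  finally have law: "spmf (occupied_law q (take (Suc r) as)) T
      = c1 * spmf (occupied_law q (take r as)) S1 + c2 * spmf (occupied_law q (take r as)) S2" .
  have c: "qint q (Suc r) * c1 = qint q (a + i)"
    "qint q (Suc r) * c2 = qint q (Suc r) - qint q (a + i - 1)"
    using qint_pos[OF q, of "Suc r"] by (simp_all add: c1_def c2_def right_diff_distrib)
  have "qfact q (Suc r) * spmf (occupied_law q (take (Suc r) as)) T
      = qint q (a + i) * (qfact q r * spmf (occupied_law q (take r as)) S1)
        + (qint q (Suc r) - qint q (a + i - 1)) * (qfact q r * spmf (occupied_law q (take r as)) S2)"
    unfolding law qfact_Suc c[symmetric] by (simp add: distrib_left mult.assoc mult.left_commute)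
  also have "qfact q r * spmf (occupied_law q (take r as)) S1 = eul_coeff q (take r as) i"
    using Suc.IH[of i] Suc.prems by (simp add: S1_def)
  also have "qfact q r * spmf (occupied_law q (take r as)) S2
      = (if i = 0 then 0 else eul_coeff q (take r as) (i - 1))"
  proof (cases i)
    case 0
    \<comment> \<open>For \<open>i = 0\<close> the set \<open>S2\<close> starts at site 2, whereas
      every relevant occupied interval starts at site 1 or further left.\<close>
    have "S2 \<notin> set_spmf (occupied_law q (take r as))"
    proof
      assume "S2 \<in> set_spmf (occupied_law q (take r as))"
      then obtain x where "x \<le> 0" "S2 = {x + 1..x + int r}"
        using occupied_law_interval[of r S2] r 0 by (auto simp: S2_def)
      then show False using r 0 by (auto simp: S2_def Icc_eq_Icc)
    qed
    then show ?thesis by (simp add: 0 in_set_spmf_iff_spmf)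
  next
    case (Suc i')
    have "S2 = {1 - int i'..int r - int i'}" by (auto simp: S2_def Suc)
    then show ?thesis using Suc.IH[of i'] Suc.prems Suc by simp
  qed
  finally show ?case
    using eul_coeff_snoc[of a q "take r as" i] a r len
    by (auto simp: T_def take_Suc_as a_def)
qed

end

section \<open>Both formulas for the remixed Eulerian numbers\<close>

theorem theorem5p6:
  fixes q :: real and n m k :: nat and \<gamma> :: "nat list"
  assumes "q > 0"
    and "n \<ge> 1"
    and "m \<in> {1..n}"
    and "length \<gamma> = m"
    and "\<gamma> ! 0 > 0"
    and "\<gamma> ! (m - 1) > 0"
    and "sum_list \<gamma> = n"
    and "k \<in> {0..n - m}"
    and "weakly_Lukasiewicz q (padded n \<gamma> k)"
    and "\<forall>k' \<in> {0..n - m}. weakly_Lukasiewicz q (padded n \<gamma> k') \<longrightarrow> k' \<le> k"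
  shows "(\<forall>i \<le> k.
            fps_nth (\<Sum>i=0..n - m. fps_X ^ i * fps_const (remixed_eulerian q (padded n \<gamma> i))) i
          = fps_nth (qpoch fps_X (fps_const q) (n + 1)
                     * Abs_fps (\<lambda>j. \<Prod>a\<in>#MSet \<gamma>. qint q (j + a))) i)
       \<and> remixed_eulerian q (padded n \<gamma> k)
          = (\<Sum>j=0..k. (-1) ^ (j + k) * q ^ ((k - j) choose 2) * qbinom q (n + 1) (k - j)
                * (\<Prod>a\<in>#MSet \<gamma>. qint q (j + a)))"
proof -
  define as where "as = left_to_right \<gamma>"
  have mset_as: "mset as = MSet \<gamma>"
    by (simp add: as_def mset_left_to_right)
  have set_as: "set as = {Suc j |j. j < m \<and> \<gamma> ! j > 0}"
    unfolding set_mset_mset[symmetric] mset_as set_mset_MSet assms(4) ..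
  have len: "length as = n"
    unfolding size_mset[symmetric] mset_as size_MSet by (rule assms(7))
  have sorted: "sorted as"
    by (simp add: as_def left_to_right_def)
  have bound: "set as \<subseteq> {1..m}"
    by (auto simp: set_as)
  \<comment> \<open>Since the first entry of \<gamma> is positive, some ball starts at 1, the least
    possible site; sortedness puts such a ball first.\<close>
  have "1 \<in> set as"
    using assms(3,5) by (auto simp: set_as)
  then obtain j where "j < length as" "as ! j = 1"
    by (auto simp: in_set_conv_nth)
  moreover have "as ! 0 \<in> set as"
    using len assms(2) by (intro nth_mem) auto
  ultimately have first: "as ! 0 = 1"
    using sorted_nth_mono[OF sorted, of 0 j] bound by fastforce
  have k: "m + k \<le> n"
    using assms(3,8) by auto
  have len_padded: "length (padded n \<gamma> i) = n" if "i \<le> n - m" for i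
    using that assms(3,4) by (auto simp: padded_def)
  have intervals: "\<exists>a b. set (take j ys) = {a..b}"
    if ys: "ys \<in> set_spmf (drop_balls q {} (map int as))" "set ys \<subseteq> {1 - int k..int n - int k}"
      and j: "1 \<le> j" "j \<le> length ys" for ys j
  proof -
    have "map ((+) (int k)) ys \<in> set_spmf (run_law q (padded n \<gamma> k))"
      using ys by (auto simp: run_law_padded as_def)
    moreover have "set (map ((+) (int k)) ys) \<subseteq> {1..int (length (padded n \<gamma> k))}"
      using ys(2) len_padded[of k] assms(8) by auto
    ultimately obtain a b where "set (take j (map ((+) (int k)) ys)) = {a..b}"
      using assms(9) j unfolding weakly_Lukasiewicz_def by fastforce
    then have "(+) (int k) ` set (take j ys) = {a..b}"
      by (simp add: take_map)
    then have "(+) (- int k) ` (+) (int k) ` set (take j ys) = (+) (- int k) ` {a..b}"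
      by simp
    then show ?thesis
      by (auto simp: image_image)
  qed
  \<comment> \<open>The case \<open>r = n\<close>, where the prefix is all of
    \<open>as\<close>.\<close>
  have eul: "remixed_eulerian q (padded n \<gamma> i) = eul_coeff q as i" if "i \<le> k" for i
    using occupied_law_eul_coeff[OF assms(1) len first bound assms(2) k intervals assms(2) order_refl that]
      len_padded[of i] that assms(8) len
    by (simp add: remixed_eulerian_def fill_prob_padded as_def)
  have prod: "(\<Prod>a\<in>#MSet \<gamma>. qint q (j + a)) = (\<Prod>a\<leftarrow>as. qint q (j + a))" for j
    by (simp add: mset_as[symmetric] prod_mset_prod_list flip: mset_map)
  have "fps_nth (\<Sum>i=0..n - m. fps_X ^ i * fps_const (remixed_eulerian q (padded n \<gamma> i))) i
      = eul_coeff q as i" if "i \<le> k" for i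
    using that assms(8) eul[OF that]
    by (simp add: fps_sum_nth mult_delta_left)
  moreover have "remixed_eulerian q (padded n \<gamma> k)
      = (\<Sum>j=0..k. (-1) ^ (j + k) * q ^ ((k - j) choose 2) * qbinom q (n + 1) (k - j)
                * (\<Prod>a\<in>#MSet \<gamma>. qint q (j + a)))"
  proof -
    have "eul_coeff q as k = (\<Sum>j=0..k. poch_coeff q (Suc n) (k - j) * (\<Prod>a\<leftarrow>as. qint q (j + a)))"
      unfolding eul_coeff_sum len
      by (rule sum.reindex_bij_witness[of _ "\<lambda>j. k - j" "\<lambda>j. k - j"]) auto
    also have "\<dots> = (\<Sum>j=0..k. (-1) ^ (j + k) * q ^ ((k - j) choose 2) * qbinom q (n + 1) (k - j)
                * (\<Prod>a\<leftarrow>as. qint q (j + a)))"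
    proof (rule sum.cong[OF refl])
      fix j assume "j \<in> {0..k}"
      \<comment> \<open>The first fact admits the q-binomial formula; the second shows that
        \<open>j + k\<close> and \<open>k - j\<close> have the same parity.\<close>
      then have j: "k - j \<le> Suc n" "j + k = (k - j) + 2 * j"
        using k by auto
      have "(- 1 :: real) ^ (j + k) = (- 1) ^ (k - j)"
        unfolding j(2) by (simp add: power_add)
      then show "poch_coeff q (Suc n) (k - j) * (\<Prod>a\<leftarrow>as. qint q (j + a))
        = (-1) ^ (j + k) * q ^ ((k - j) choose 2) * qbinom q (n + 1) (k - j)
                * (\<Prod>a\<leftarrow>as. qint q (j + a))"
        using poch_coeff_qbinom[OF assms(1) j(1)] by simp
    qed
    finally show ?thesis using eul[of k] by (simp add: prod)
  qed
  ultimately show ?thesis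
    by (auto simp: eul_coeff_def len prod)
qed

end
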